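(* Let $\alpha_1, A_1, \beta_2 > 0$ and consider the system of difference equations $$x_{n+1}=\frac{\alpha_{1}}{A_{1}+y_{n}},\qquad y_{n+1}=\beta_{2}x_{n},\qquad n=0,1,2,\dots,$$ with arbitrary nonnegative initial conditions $x_0,y_0$. There is a unique nonnegative equilibrium, namely $$(\bar{x},\bar{y})= \left(\frac{-A_{1}+\sqrt{A_{1}^{2}+4\beta_{2}\alpha_{1}}}{2\beta_{2}},\frac{-A_{1}+\sqrt{A_{1}^{2}+4\beta_{2}\alpha_{1}}}{2}\right),$$ and it is globally asymptotically stable.
   Context: The state space is $[0,\infty)^2$. A nonnegative equilibrium is a point $(\bar x,\bar y)\in[0,\infty)^2$ such that the constant sequence $(x_n,y_n)=(\bar x,\bar y)$ solves the system. It is globally asymptotically stable if it is Lyapunov stable relative to $[0,\infty)^2$ (for every $\varepsilon>0$ there is $\delta>0$ such that every initial condition in $[0,\infty)^2$ within $\delta$ of $(\bar x,\bar y)$ has its whole orbit within $\varepsilon$ of $(\bar x,\bar y)$) and every solution with initial condition in $[0,\infty)^2$ converges to $(\bar x,\bar y)$. *)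

theory Defs
  imports "HOL-Analysis.Analysis"
begin

definition state_space :: "(real \<times> real) set" where
  "state_space = {0..} \<times> {0..}"

text \<open>Parameters in the order \<open>\<alpha>\<^sub>1\<close>, \<open>A\<^sub>1\<close>, \<open>\<beta>\<^sub>2\<close>. Initial values are not constrained here; the notions
  below require \<open>z 0 \<in> state_space\<close>, so that for positive parameters no denominator vanishes.\<close>

definition is_solution :: "real \<Rightarrow> real \<Rightarrow> real \<Rightarrow> (nat \<Rightarrow> real \<times> real) \<Rightarrow> bool" where
  "is_solution \<alpha> A \<beta> z \<longleftrightarrow>
     (\<forall>n. fst (z (Suc n)) = \<alpha> / (A + snd (z n)) \<and> snd (z (Suc n)) = \<beta> * fst (z n))"

definition nonneg_equilibrium :: "real \<Rightarrow> real \<Rightarrow> real \<Rightarrow> real \<times> real \<Rightarrow> bool" where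
  "nonneg_equilibrium \<alpha> A \<beta> p \<longleftrightarrow> p \<in> state_space \<and> is_solution \<alpha> A \<beta> (\<lambda>n. p)"

definition lyapunov_stable :: "real \<Rightarrow> real \<Rightarrow> real \<Rightarrow> real \<times> real \<Rightarrow> bool" where
  "lyapunov_stable \<alpha> A \<beta> p \<longleftrightarrow>
     (\<forall>\<epsilon>>0. \<exists>\<delta>>0. \<forall>z. is_solution \<alpha> A \<beta> z \<and> z 0 \<in> state_space \<and> dist (z 0) p < \<delta>
        \<longrightarrow> (\<forall>n. dist (z n) p < \<epsilon>))"

definition globally_attracting :: "real \<Rightarrow> real \<Rightarrow> real \<Rightarrow> real \<times> real \<Rightarrow> bool" where
  "globally_attracting \<alpha> A \<beta> p \<longleftrightarrow>
     (\<forall>z. is_solution \<alpha> A \<beta> z \<and> z 0 \<in> state_space \<longrightarrow> z \<longlonglongrightarrow> p)"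

definition globally_asymptotically_stable :: "real \<Rightarrow> real \<Rightarrow> real \<Rightarrow> real \<times> real \<Rightarrow> bool" where
  "globally_asymptotically_stable \<alpha> A \<beta> p \<longleftrightarrow>
     lyapunov_stable \<alpha> A \<beta> p \<and> globally_attracting \<alpha> A \<beta> p"

end

(* In any solution y(n+2) = g (y n) for g y = \<alpha> \<beta> / (A + y), and x n = y(n+1) / \<beta>, so everything
   reduces to the decreasing map g.  One step of g may expand distances to the fixed point Y (when Y > A), but
     g (g y) - Y = Y^2 / ((A + g y) (A + y)) * (y - Y)
   with (A + g y) (A + y) = A (A + y) + Y (A + Y) \<ge> A^2 + A Y + Y^2, so two steps contract by a constant
   factor k < 1.  Hence orbits approach the equilibrium geometrically, at a rate linear in the
   initial distance, which yields both stability and attraction. *)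
theory Submission
  imports Defs
begin

text \<open>Clears the denominator, which is nonzero because \<open>A + y > 0\<close>, so that later
  arguments about equilibria are polynomial algebra.\<close>

lemma nonneg_equilibrium_iff:
  assumes "A > 0"
  shows "nonneg_equilibrium \<alpha> A \<beta> (x, y) \<longleftrightarrow> x \<ge> 0 \<and> y \<ge> 0 \<and> x * (A + y) = \<alpha> \<and> y = \<beta> * x"
proof -
  have "x = \<alpha> / (A + y) \<longleftrightarrow> x * (A + y) = \<alpha>" if "y \<ge> 0"
    using that assms by (simp add: eq_divide_eq)
  then show ?thesis
    by (auto simp: nonneg_equilibrium_def is_solution_def state_space_def)
qed

lemma nonneg_equilibrium_unique:
  assumes "A > 0" "\<beta> > 0"
    and p: "nonneg_equilibrium \<alpha> A \<beta> p" and q: "nonneg_equilibrium \<alpha> A \<beta> q"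
  shows "p = q"
proof -
  obtain x y u v where pq: "p = (x, y)" "q = (u, v)"
    by (metis surj_pair)
  have xy: "x \<ge> 0" "y \<ge> 0" "x * (A + y) = \<alpha>" "y = \<beta> * x"
    and uv: "u \<ge> 0" "v \<ge> 0" "u * (A + v) = \<alpha>" "v = \<beta> * u"
    using p q assms(1) by (auto simp: pq nonneg_equilibrium_iff)
  \<comment> \<open>The cross terms cancel, since \<open>x * v\<close> and \<open>u * y\<close> both
    equal \<open>\<beta> * x * u\<close>. The factor \<open>A + y + v\<close> is positive, which
    forces \<open>x = u\<close>.\<close>
  have "(x - u) * (A + y + v) = x * (A + y) - u * (A + v) + x * v - u * y"
    by (simp add: algebra_simps)
  also have "\<dots> = 0"
    using xy uv by simp
  finally have "x = u"
    using xy uv assms(1) by simp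
  then show ?thesis
    using pq xy uv by simp
qed

text \<open>With x = Y / \<beta> the equilibrium equations reduce to the quadratic
  \<open>Y * (A + Y) = \<beta> * \<alpha>\<close>, and \<open>Y\<close> is its nonnegative
  root.\<close>

lemma quadratic_root_equilibrium:
  fixes \<alpha> A \<beta> :: real
  assumes "\<alpha> > 0" "A > 0" "\<beta> > 0"
  defines "Y \<equiv> (- A + sqrt (A\<^sup>2 + 4 * \<beta> * \<alpha>)) / 2"
  shows "nonneg_equilibrium \<alpha> A \<beta> (Y / \<beta>, Y)"
proof -
  have "A \<le> sqrt (A\<^sup>2 + 4 * \<beta> * \<alpha>)"
    using assms by (intro real_le_rsqrt) simp
  then have "Y \<ge> 0"
    by (simp add: Y_def)
  have "2 * Y + A = sqrt (A\<^sup>2 + 4 * \<beta> * \<alpha>)"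
    by (simp add: Y_def field_simps)
  then have "(2 * Y + A)\<^sup>2 = A\<^sup>2 + 4 * \<beta> * \<alpha>"
    using assms(1-3) by simp
  then have "Y * (A + Y) = \<beta> * \<alpha>"
    by (simp add: power2_eq_square algebra_simps)
  then show ?thesis
    using \<open>Y \<ge> 0\<close> assms by (simp add: nonneg_equilibrium_iff field_simps)
qed

text \<open>The exponent \<open>n div 4\<close> counts completed blocks of four indices, and
  \<open>M\<close> covers the first block. Four is the right period here because one application of
  g advances the index by two and contraction takes two applications.\<close>

lemma geometric_bound_period_4:
  fixes e :: "nat \<Rightarrow> real"
  assumes "k \<ge> 0" and init: "\<And>n. n < 4 \<Longrightarrow> e n \<le> M"
    and step: "\<And>n. e (n + 4) \<le> k * e n"
  shows "e n \<le> M * k ^ (n div 4)"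
proof (induction n rule: less_induct)
  case (less n)
  show ?case
  proof (cases "n < 4")
    case True
    then show ?thesis using init by simp
  next
    case False
    then obtain m where n: "n = m + 4"
      by (metis add.commute le_Suc_ex not_less)
    have "e n \<le> k * e m"
      using step n by simp
    also have "\<dots> \<le> k * (M * k ^ (m div 4))"
      using less[of m] n assms(1) by (simp add: mult_left_mono)
    finally show ?thesis
      by (simp add: n mult_ac)
  qed
qed

text \<open>\<open>K\<close> and \<open>k\<close> are chosen before the orbit. This uniformity gives
  Lyapunov stability, while \<open>k < 1\<close> gives attraction.\<close>

lemma exponential_stability:
  assumes pos: "A > 0" "\<beta> > 0" and p: "nonneg_equilibrium \<alpha> A \<beta> p"
  obtains K k :: real where "K > 0" "0 \<le> k" "k < 1"
    "\<And>z n. is_solution \<alpha> A \<beta> z \<Longrightarrow> z 0 \<in> state_space \<Longrightarrow>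
       dist (z n) p \<le> K * k ^ (n div 4) * dist (z 0) p"
proof -
  obtain X Y where pXY: "p = (X, Y)" by (metis surj_pair)
  have X: "X \<ge> 0" and Y: "Y \<ge> 0" and \<alpha>: "\<alpha> = X * (A + Y)" and YX: "Y = \<beta> * X"
    using p pos by (auto simp: pXY nonneg_equilibrium_iff)
  define k where "k = Y\<^sup>2 / (A\<^sup>2 + A * Y + Y\<^sup>2)"
  \<comment> \<open>\<open>Y / A\<close> bounds the factor by which one application of g changes the
    distance to \<open>Y\<close>; the maximum with 1 lets \<open>L\<close> also cover the initial
    errors themselves.\<close>
  define L where "L = max 1 (Y / A)"
  \<comment> \<open>The factor \<open>1 + \<beta>\<close> bounds \<open>e 0 + e 1\<close> by the
    initial distance, \<open>L\<close> extends this to the first four errors, and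
    \<open>1 / \<beta> + 1\<close> converts errors in y back to distances in the plane.\<close>
  define K where "K = (1 / \<beta> + 1) * L * (1 + \<beta>)"
  have D: "A\<^sup>2 + A * Y + Y\<^sup>2 > 0"
    using pos Y by (simp add: add_pos_nonneg)
  have k0: "k \<ge> 0"
    using D by (simp add: k_def)
  have k1: "k < 1"
    using D pos Y by (simp add: k_def add_pos_nonneg)
  have L1: "L \<ge> 1" and LA: "Y / A \<le> L"
    by (auto simp: L_def)
  have "K > 0"
    using pos L1 by (auto simp: K_def intro!: mult_pos_pos add_pos_pos)
  moreover have "dist (z n) p \<le> K * k ^ (n div 4) * dist (z 0) p"
    if sol: "is_solution \<alpha> A \<beta> z" and z0: "z 0 \<in> state_space" for z n
  proof -
    define y where "y n = snd (z n)" for n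
    define e where "e n = \<bar>y n - Y\<bar>" for n
    have x: "y (Suc n) = \<beta> * fst (z n)" for n
      using sol by (simp add: is_solution_def y_def)
    have y2: "y (n + 2) = Y * (A + Y) / (A + y n)" for n
      using sol by (simp add: is_solution_def y_def \<alpha> YX)
    \<comment> \<open>The recurrence has delay two, so the induction needs two base cases:
      \<open>y 0\<close> and \<open>y 1 = \<beta> * fst (z 0)\<close>.\<close>
    have y0: "y n \<ge> 0" for n
    proof (induction n rule: less_induct)
      case (less n)
      show ?case
      proof (cases "n < 2")
        case True
        then have "n = 0 \<or> n = Suc 0" by auto
        then show ?thesis
          using z0 pos x[of 0] by (auto simp: y_def state_space_def mem_Times_iff)
      next
        case False
        then obtain m where "n = m + 2"
          by (metis add.commute le_Suc_ex not_less)
        then show ?thesis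
          using less[of m] y2[of m] pos Y by simp
      qed
    qed
    have diff2: "y (n + 2) - Y = - (Y / (A + y n)) * (y n - Y)" for n
      using y0[of n] pos unfolding y2 by (simp add: field_simps)
    have e2: "e (n + 2) \<le> L * e n" for n
    proof -
      have "e (n + 2) = Y / (A + y n) * e n"
        unfolding e_def diff2 abs_mult using y0[of n] pos Y by simp
      also have "Y / (A + y n) \<le> Y / A"
        using y0[of n] pos Y by (intro divide_left_mono) auto
      also note LA
      finally show ?thesis
        by (simp add: e_def mult_right_mono)
    qed
    have e4: "e (n + 4) \<le> k * e n" for n
    proof -
      have "y (n + 4) - Y = - (Y / (A + y (n + 2))) * (y (n + 2) - Y)"
        using diff2[of "n + 2"] by (simp only: add.assoc numeral_plus_numeral add_num_simps)
      also have "\<dots> = Y\<^sup>2 / ((A + y (n + 2)) * (A + y n)) * (y n - Y)"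
        unfolding diff2 by (simp add: power2_eq_square)
      \<comment> \<open>Since \<open>y (n + 2) * (A + y n) = Y * (A + Y)\<close>, the product
        depends on \<open>y n\<close> alone and is smallest at \<open>y n = 0\<close>, where the
        quotient becomes \<open>k\<close>.\<close>
      also have "(A + y (n + 2)) * (A + y n) = A * (A + y n) + Y * (A + Y)"
        using y0[of n] pos unfolding y2 by (simp add: field_simps)
      finally have "e (n + 4) = Y\<^sup>2 / (A * (A + y n) + Y * (A + Y)) * e n"
        using y0[of n] pos Y by (simp add: e_def abs_mult)
      also have "Y\<^sup>2 / (A * (A + y n) + Y * (A + Y)) \<le> k"
        unfolding k_def using D y0[of n] pos Y
        by (intro divide_left_mono mult_pos_pos)
          (auto simp: power2_eq_square algebra_simps intro!: add_pos_nonneg)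
      finally show ?thesis
        by (simp add: e_def mult_right_mono)
    qed
    \<comment> \<open>Errors 0 and 1 are below \<open>M\<close> because \<open>L \<ge> 1\<close>;
      errors 2 and 3 come from these by one application of g.\<close>
    define M where "M = L * (e 0 + e 1)"
    have e_init: "e n \<le> M" if "n < 4" for n
    proof -
      have e01: "e 0 \<ge> 0" "e 1 \<ge> 0" by (auto simp: e_def)
      have "1 * (e 0 + e 1) \<le> M"
        unfolding M_def using L1 e01 by (intro mult_right_mono) auto
      moreover have "e 2 \<le> L * e 0" "e 3 \<le> L * e 1"
        using e2[of 0] e2[of 1] by (auto simp: numeral_eq_Suc)
      moreover have "L * e 0 \<ge> 0" "L * e 1 \<ge> 0"
        using L1 e01 by auto
      moreover have "n = 0 \<or> n = 1 \<or> n = 2 \<or> n = 3"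
        using that by auto
      ultimately show ?thesis
        using e01 by (auto simp: M_def distrib_left)
    qed
    have e_bound: "e n \<le> M * k ^ (n div 4)" for n
      using geometric_bound_period_4[of k e M n] k0 e_init e4 by simp
    have M0: "M \<ge> 0"
      using L1 by (auto simp: M_def e_def)
    \<comment> \<open>The first coordinate at time n is read off from y at time n + 1; as
      \<open>k < 1\<close>, the later index may be given the same exponent
      \<open>n div 4\<close>.\<close>
    have "k ^ (Suc n div 4) \<le> k ^ (n div 4)"
      using k0 k1 by (intro power_decreasing div_le_mono) auto
    then have e_Suc: "e (Suc n) \<le> M * k ^ (n div 4)"
      using e_bound[of "Suc n"] M0 by (meson mult_left_mono order_trans)
    have ex: "e (Suc n) = \<beta> * dist (fst (z n)) X" for n
      using pos by (simp add: e_def x YX dist_real_def abs_mult flip: right_diff_distrib)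
    have M_le: "M \<le> L * ((1 + \<beta>) * dist (z 0) p)"
    proof -
      have "e 0 \<le> dist (z 0) p"
        using dist_snd_le[of "z 0" p] by (simp add: e_def y_def pXY dist_real_def)
      moreover have "e 1 \<le> \<beta> * dist (z 0) p"
        using dist_fst_le[of "z 0" p] ex[of 0] pos by (simp add: pXY)
      ultimately show ?thesis
        unfolding M_def using L1 by (intro mult_left_mono) (auto simp: algebra_simps)
    qed
    have "dist (z n) p \<le> dist (fst (z n)) X + dist (snd (z n)) Y"
      by (simp add: dist_prod_def pXY sqrt_sum_squares_le_sum)
    also have "\<dots> = e (Suc n) / \<beta> + e n"
      unfolding ex using pos by (simp add: e_def y_def dist_real_def)
    also have "\<dots> \<le> M * k ^ (n div 4) / \<beta> + M * k ^ (n div 4)"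
      using e_Suc e_bound[of n] pos by (intro add_mono divide_right_mono) auto
    also have "\<dots> = (1 / \<beta> + 1) * k ^ (n div 4) * M"
      by (simp add: algebra_simps)
    also have "\<dots> \<le> (1 / \<beta> + 1) * k ^ (n div 4) * (L * ((1 + \<beta>) * dist (z 0) p))"
      using M_le pos k0 by (intro mult_left_mono) auto
    finally show ?thesis
      by (simp only: K_def mult_ac)
  qed
  ultimately show ?thesis
    using that k0 k1 by blast
qed

lemma globally_asymptotically_stable_equilibrium:
  assumes "A > 0" "\<beta> > 0" and "nonneg_equilibrium \<alpha> A \<beta> p"
  shows "globally_asymptotically_stable \<alpha> A \<beta> p"
proof -
  obtain K k :: real where K: "K > 0" and k: "0 \<le> k" "k < 1"
    and bound: "\<And>z n. is_solution \<alpha> A \<beta> z \<Longrightarrow> z 0 \<in> state_space \<Longrightarrow>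
       dist (z n) p \<le> K * k ^ (n div 4) * dist (z 0) p"
    using exponential_stability[OF assms] by blast
  have "lyapunov_stable \<alpha> A \<beta> p"
    unfolding lyapunov_stable_def
  proof (intro allI impI)
    fix \<epsilon> :: real assume "\<epsilon> > 0"
    \<comment> \<open>The radius \<open>\<epsilon> / K\<close> suffices for all times at once
      because the powers of \<open>k\<close> never exceed 1.\<close>
    have "dist (z n) p < \<epsilon>"
      if "is_solution \<alpha> A \<beta> z" "z 0 \<in> state_space" "dist (z 0) p < \<epsilon> / K" for z n
    proof -
      have "k ^ (n div 4) \<le> 1"
        using k by (simp add: power_le_one)
      then have "K * k ^ (n div 4) * dist (z 0) p \<le> K * 1 * dist (z 0) p"
        using K by (intro mult_right_mono mult_left_mono) auto
      also have "\<dots> < \<epsilon>"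
        using that K by (simp add: field_simps)
      finally show ?thesis
        using bound[OF that(1,2), of n] by simp
    qed
    then show "\<exists>\<delta>>0. \<forall>z. is_solution \<alpha> A \<beta> z \<and> z 0 \<in> state_space \<and> dist (z 0) p < \<delta>
        \<longrightarrow> (\<forall>n. dist (z n) p < \<epsilon>)"
      using \<open>\<epsilon> > 0\<close> K by (intro exI[of _ "\<epsilon> / K"]) auto
  qed
  moreover have "globally_attracting \<alpha> A \<beta> p"
    unfolding globally_attracting_def
  proof (intro allI impI, elim conjE)
    fix z assume z: "is_solution \<alpha> A \<beta> z" "z 0 \<in> state_space"
    \<comment> \<open>The exponent \<open>n div 4\<close> tends to infinity, so the geometric bound
      tends to 0 and squeezes the distance.\<close>
    have "filterlim (\<lambda>n::nat. n div 4) at_top sequentially"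
      by (rule filterlim_at_top_div_const_nat) simp
    then have "(\<lambda>n. k ^ (n div 4)) \<longlonglongrightarrow> 0"
      using filterlim_compose[OF LIMSEQ_power_zero[of k]] k by auto
    then have "(\<lambda>n. K * k ^ (n div 4) * dist (z 0) p) \<longlonglongrightarrow> K * 0 * dist (z 0) p"
      by (intro tendsto_intros)
    then have "(\<lambda>n. K * k ^ (n div 4) * dist (z 0) p) \<longlonglongrightarrow> 0"
      by simp
    then have "(\<lambda>n. dist (z n) p) \<longlonglongrightarrow> 0"
      by (rule tendsto_sandwich[OF _ _ tendsto_const, rotated 2]) (simp_all add: bound[OF z])
    then show "z \<longlonglongrightarrow> p"
      using tendsto_dist_iff by blast
  qed
  ultimately show ?thesis
    by (simp add: globally_asymptotically_stable_def)
qed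

theorem theorem6:
  fixes \<alpha>\<^sub>1 A\<^sub>1 \<beta>\<^sub>2 :: real
  assumes "\<alpha>\<^sub>1 > 0" and "A\<^sub>1 > 0" and "\<beta>\<^sub>2 > 0"
  shows "let p = ((- A\<^sub>1 + sqrt (A\<^sub>1\<^sup>2 + 4 * \<beta>\<^sub>2 * \<alpha>\<^sub>1)) / (2 * \<beta>\<^sub>2),
                  (- A\<^sub>1 + sqrt (A\<^sub>1\<^sup>2 + 4 * \<beta>\<^sub>2 * \<alpha>\<^sub>1)) / 2)
         in (\<forall>q. nonneg_equilibrium \<alpha>\<^sub>1 A\<^sub>1 \<beta>\<^sub>2 q \<longleftrightarrow> q = p)
            \<and> globally_asymptotically_stable \<alpha>\<^sub>1 A\<^sub>1 \<beta>\<^sub>2 p"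
proof -
  define p where "p = ((- A\<^sub>1 + sqrt (A\<^sub>1\<^sup>2 + 4 * \<beta>\<^sub>2 * \<alpha>\<^sub>1)) / (2 * \<beta>\<^sub>2),
                  (- A\<^sub>1 + sqrt (A\<^sub>1\<^sup>2 + 4 * \<beta>\<^sub>2 * \<alpha>\<^sub>1)) / 2)"
  have p: "nonneg_equilibrium \<alpha>\<^sub>1 A\<^sub>1 \<beta>\<^sub>2 p"
    using quadratic_root_equilibrium[OF assms] by (simp add: p_def)
  then have "\<forall>q. nonneg_equilibrium \<alpha>\<^sub>1 A\<^sub>1 \<beta>\<^sub>2 q \<longleftrightarrow> q = p"
    using nonneg_equilibrium_unique assms by blast
  then show ?thesis
    using globally_asymptotically_stable_equilibrium p assms
    unfolding p_def[symmetric] Let_def by blast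
qed

end
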